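(* Let $G$ be a group, let $X$ be an infinite transitive $G$-space, and let $J$ be a translation invariant ideal in $\mathcal{P}_X$. If a subset $A$ of $X$ is $J$-prethick, then $\Delta_J(A)$ is large in $G$.
   Context: $\mathcal{P}_X$ is the Boolean algebra of all subsets of $X$, and $[G]^{<\omega}$ is the family of all finite subsets of $G$. For $F\subseteq G$, $A\subseteq X$: $FA=\{ga: g\in F, a\in A\}$, $gA=\{ga:a\in A\}$. An ideal $J$ in $\mathcal{P}_X$ is a family of subsets of $X$ with $X\notin J$ such that $A,B\in J$ and $C\subseteq A$ imply $A\cup B\in J$ and $C\in J$ (the ideal $\{\varnothing\}$ is allowed). $J$ is translation invariant if $gA\in J$ for all $g\in G$, $A\in J$. A subset $A\subseteq X$ is $J$-thick if $Int_F(A)\notin J$ for each $F\in[G]^{<\omega}$, where $Int_F(A)=\{a\in A: Fa\subseteq A\}$; $A$ is $J$-prethick if $FA$ is $J$-thick for some $F\in[G]^{<\omega}$. The combinatorial derivation relative to $J$ is $\Delta_J:\mathcal{P}_X\to\mathcal{P}_G$, $\Delta_J(A)=\{g\in G: gA\cap A\notin J\}$. A subset $S\subseteq G$ is large in $G$ if $G=FS$ for some $F\in[G]^{<\omega}$. *)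

theory Defs
  imports "HOL-Algebra.Group_Action"
begin

text \<open>
  A \<open>G\<close>-space is an action \<open>\<phi>\<close> in the sense of \<^locale>\<open>group_action\<close>, so \<open>ga\<close> is
  written \<open>\<phi> g a\<close> and the translate \<open>gA\<close> is the image \<open>\<phi> g ` A\<close>.
\<close>

text \<open>
  Only the listed closure conditions are required; in particular \<open>J = {{}}\<close> is an ideal.
  Every nonempty such family contains \<open>{}\<close>. Nonemptiness is not imposed, so results about
  these families hold in particular for ideals in the stricter, nonempty sense.
\<close>
definition ideal_of_sets :: "'b set \<Rightarrow> 'b set set \<Rightarrow> bool"
  where "ideal_of_sets X J \<longleftrightarrow>
    J \<subseteq> Pow X \<and> X \<notin> J \<and>
    (\<forall>A\<in>J. \<forall>B\<in>J. A \<union> B \<in> J) \<and>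
    (\<forall>A\<in>J. \<forall>C. C \<subseteq> A \<longrightarrow> C \<in> J)"

definition translation_invariant ::
    "('a, 'm) monoid_scheme \<Rightarrow> ('a \<Rightarrow> 'b \<Rightarrow> 'b) \<Rightarrow> 'b set set \<Rightarrow> bool"
  where "translation_invariant G \<phi> J \<longleftrightarrow> (\<forall>g\<in>carrier G. \<forall>A\<in>J. \<phi> g ` A \<in> J)"

definition set_act :: "('a \<Rightarrow> 'b \<Rightarrow> 'b) \<Rightarrow> 'a set \<Rightarrow> 'b set \<Rightarrow> 'b set"
  where "set_act \<phi> F A = {\<phi> g a | g a. g \<in> F \<and> a \<in> A}"

definition Int_rel :: "('a \<Rightarrow> 'b \<Rightarrow> 'b) \<Rightarrow> 'a set \<Rightarrow> 'b set \<Rightarrow> 'b set"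
  where "Int_rel \<phi> F A = {a \<in> A. set_act \<phi> F {a} \<subseteq> A}"

definition thick ::
    "('a, 'm) monoid_scheme \<Rightarrow> ('a \<Rightarrow> 'b \<Rightarrow> 'b) \<Rightarrow> 'b set set \<Rightarrow> 'b set \<Rightarrow> bool"
  where "thick G \<phi> J A \<longleftrightarrow>
    (\<forall>F. finite F \<and> F \<subseteq> carrier G \<longrightarrow> Int_rel \<phi> F A \<notin> J)"

definition prethick ::
    "('a, 'm) monoid_scheme \<Rightarrow> ('a \<Rightarrow> 'b \<Rightarrow> 'b) \<Rightarrow> 'b set set \<Rightarrow> 'b set \<Rightarrow> bool"
  where "prethick G \<phi> J A \<longleftrightarrow>
    (\<exists>F. finite F \<and> F \<subseteq> carrier G \<and> thick G \<phi> J (set_act \<phi> F A))"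

definition comb_derivation ::
    "('a, 'm) monoid_scheme \<Rightarrow> ('a \<Rightarrow> 'b \<Rightarrow> 'b) \<Rightarrow> 'b set set \<Rightarrow> 'b set \<Rightarrow> 'a set"
  where "comb_derivation G \<phi> J A = {g \<in> carrier G. \<phi> g ` A \<inter> A \<notin> J}"

definition large :: "('a, 'm) monoid_scheme \<Rightarrow> 'a set \<Rightarrow> bool"
  where "large G S \<longleftrightarrow>
    (\<exists>F. finite F \<and> F \<subseteq> carrier G \<and> carrier G = F <#>\<^bsub>G\<^esub> S)"

end

theory Submission
  imports Defs
begin

text \<open>
  If \<open>FA\<close> is \<open>J\<close>-thick with \<open>F\<close> finite, then already \<open>G = F \<Delta>\<^sub>J(A)\<close>. Suppose some \<open>h\<close>
  lies outside \<open>F \<Delta>\<^sub>J(A)\<close>, so that every return set \<open>f'\<^sup>-\<^sup>1hA \<inter> A\<close> with \<open>f' \<in> F\<close> is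
  small, meaning a member of \<open>J\<close>. Take a point \<open>x \<in> FA\<close> such that
  \<open>hf\<^sup>-\<^sup>1x \<in> FA\<close> for every \<open>f \<in> F\<close>. Some
  \<open>y = f\<^sup>-\<^sup>1x\<close> lies in \<open>A\<close>, and \<open>hy = hf\<^sup>-\<^sup>1x\<close> lies in some \<open>f'A\<close>, so \<open>f'\<^sup>-\<^sup>1hy\<close> lies in the
  small set \<open>f'\<^sup>-\<^sup>1hA \<inter> A\<close>. Hence \<open>x\<close> lies in one of finitely many translates of small
  sets, so the set of all such \<open>x\<close> is small. But this set is \<open>Int\<^sub>H(FA)\<close> for the finite
  set \<open>H = hF\<^sup>-\<^sup>1\<close>, which contradicts thickness.

  When \<open>F\<close> is empty the finite union in this argument is \<open>{}\<close>, so the covering needs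
  \<open>{} \<in> J\<close>, that is, a nonempty \<open>J\<close>. For the degenerate \<open>J\<close> without members,
  \<open>\<Delta>\<^sub>J(A)\<close> is the whole group.
\<close>

lemma ideal_of_sets_finite_UN:
  assumes J: "ideal_of_sets X J" and "{} \<in> J" and "finite I"
    and "\<And>i. i \<in> I \<Longrightarrow> B i \<in> J"
  shows "(\<Union>i\<in>I. B i) \<in> J"
  using assms(3,4)
proof (induction I rule: finite_induct)
  case empty
  then show ?case using assms(2) by simp
next
  case (insert i I)
  then show ?case using J by (simp add: ideal_of_sets_def)
qed

text \<open>
  A point \<open>x\<close> of the interior is traced back to some \<open>y = f\<^sup>-\<^sup>1x \<in> A\<close>. As
  \<open>hy = hf\<^sup>-\<^sup>1x\<close> lies in \<open>FA\<close>, some \<open>f'\<^sup>-\<^sup>1h\<close> returns \<open>y\<close> to \<open>A\<close>, and \<open>fh\<^sup>-\<^sup>1f'\<close> takes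
  the return point to \<open>x\<close>.
\<close>
lemma (in group_action) Int_rel_subset_translates_of_returns:
  assumes "F \<subseteq> carrier G" "h \<in> carrier G" "A \<subseteq> E"
  shows "Int_rel \<phi> ((\<lambda>f. h \<otimes> inv f) ` F) (set_act \<phi> F A)
    \<subseteq> (\<Union>(f, f')\<in>F \<times> F. \<phi> (f \<otimes> (inv h \<otimes> f')) ` (\<phi> (inv f' \<otimes> h) ` A \<inter> A))"
proof
  interpret group G using group_hom group_hom.axioms(1) by blast
  fix x
  assume x: "x \<in> Int_rel \<phi> ((\<lambda>f. h \<otimes> inv f) ` F) (set_act \<phi> F A)"
  then obtain f y where f: "f \<in> F" and y: "y \<in> A" and x_eq: "x = \<phi> f y"
    by (auto simp: Int_rel_def set_act_def)
  have fG: "f \<in> carrier G" and yE: "y \<in> E" using f y assms by auto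
  have "\<phi> (h \<otimes> inv f) x \<in> set_act \<phi> F A"
    using x f by (force simp: Int_rel_def set_act_def)
  then obtain f' z where f': "f' \<in> F" and z: "z \<in> A" and hx: "\<phi> (h \<otimes> inv f) x = \<phi> f' z"
    by (auto simp: set_act_def)
  have f'G: "f' \<in> carrier G" and zE: "z \<in> E" using f' z assms by auto
  have "\<phi> h y = \<phi> f' z"
    using hx x_eq composition_rule[OF yE, of "h \<otimes> inv f" f] assms(2) fG yE
    by (simp add: m_assoc)
  then have z_eq: "\<phi> (inv f' \<otimes> h) y = z"
    using composition_rule[OF yE, of "inv f'" h] orbit_sym_aux[OF f'G zE]
      assms(2) f'G by simp
  have "\<phi> (f \<otimes> (inv h \<otimes> f')) z = \<phi> (f \<otimes> (inv h \<otimes> f') \<otimes> (inv f' \<otimes> h)) y"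
    using composition_rule[OF yE, of "f \<otimes> (inv h \<otimes> f')" "inv f' \<otimes> h"] z_eq
      assms(2) fG f'G by simp
  also have "f \<otimes> (inv h \<otimes> f') \<otimes> (inv f' \<otimes> h) = f"
  proof -
    have "f' \<otimes> (inv f' \<otimes> h) = h"
      using assms(2) f'G by (simp add: m_assoc[symmetric])
    then show ?thesis using assms(2) fG f'G by (simp add: m_assoc)
  qed
  finally have "x = \<phi> (f \<otimes> (inv h \<otimes> f')) z" using x_eq by simp
  moreover have "z \<in> \<phi> (inv f' \<otimes> h) ` A \<inter> A" using z imageI[OF y, of "\<phi> (inv f' \<otimes> h)"] z_eq by simp
  ultimately show "x \<in> (\<Union>(f, f')\<in>F \<times> F.
      \<phi> (f \<otimes> (inv h \<otimes> f')) ` (\<phi> (inv f' \<otimes> h) ` A \<inter> A))"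
    using f f' by (intro UN_I[of "(f, f')"]) auto
qed

lemma (in group_action) carrier_eq_set_mult_comb_derivation:
  assumes J: "ideal_of_sets E J" "{} \<in> J" "translation_invariant G \<phi> J"
    and "A \<subseteq> E" and F: "finite F" "F \<subseteq> carrier G"
    and thick: "thick G \<phi> J (set_act \<phi> F A)"
  shows "carrier G = F <#> comb_derivation G \<phi> J A"
proof
  interpret group G using group_hom group_hom.axioms(1) by blast
  show "F <#> comb_derivation G \<phi> J A \<subseteq> carrier G"
    using F(2) by (auto simp: set_mult_def comb_derivation_def)
  show "carrier G \<subseteq> F <#> comb_derivation G \<phi> J A"
  proof (rule subsetI, rule ccontr)
    fix h
    assume h: "h \<in> carrier G" and not_covered: "h \<notin> F <#> comb_derivation G \<phi> J A"
    have returns: "\<phi> (inv f' \<otimes> h) ` A \<inter> A \<in> J" if f': "f' \<in> F" for f'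
    proof (rule ccontr)
      assume "\<phi> (inv f' \<otimes> h) ` A \<inter> A \<notin> J"
      moreover have f'G: "f' \<in> carrier G" using f' F(2) by blast
      ultimately have "inv f' \<otimes> h \<in> comb_derivation G \<phi> J A"
        using h by (simp add: comb_derivation_def)
      moreover have "h = f' \<otimes> (inv f' \<otimes> h)"
        using h f'G by (simp add: m_assoc[symmetric])
      ultimately show False
        using not_covered f' unfolding set_mult_def by blast
    qed
    let ?U = "\<Union>(f, f')\<in>F \<times> F. \<phi> (f \<otimes> (inv h \<otimes> f')) ` (\<phi> (inv f' \<otimes> h) ` A \<inter> A)"
    have "?U \<in> J"
    proof (rule ideal_of_sets_finite_UN[OF J(1,2)])
      show "finite (F \<times> F)" using F(1) by simp
      fix p
      assume "p \<in> F \<times> F"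
      then obtain f f' where p: "p = (f, f')" "f \<in> F" "f' \<in> F" by blast
      then have "f \<otimes> (inv h \<otimes> f') \<in> carrier G" using h F(2) by blast
      then show "(case p of (f, f') \<Rightarrow>
          \<phi> (f \<otimes> (inv h \<otimes> f')) ` (\<phi> (inv f' \<otimes> h) ` A \<inter> A)) \<in> J"
        using J(3) returns p unfolding translation_invariant_def by simp
    qed
    then have "Int_rel \<phi> ((\<lambda>f. h \<otimes> inv f) ` F) (set_act \<phi> F A) \<in> J"
      using Int_rel_subset_translates_of_returns[OF F(2) h \<open>A \<subseteq> E\<close>] J(1)
      unfolding ideal_of_sets_def by blast
    moreover have "finite ((\<lambda>f. h \<otimes> inv f) ` F)" "(\<lambda>f. h \<otimes> inv f) ` F \<subseteq> carrier G"
      using F h by auto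
    ultimately show False using thick unfolding thick_def by blast
  qed
qed

theorem theorem2p4:
  fixes G :: "('a, 'm) monoid_scheme"
    and X :: "'b set"
    and \<phi> :: "'a \<Rightarrow> 'b \<Rightarrow> 'b"
    and J :: "'b set set"
    and A :: "'b set"
  assumes "group G"
    and "transitive_action G X \<phi>"
    and "infinite X"
    and "ideal_of_sets X J"
    and "translation_invariant G \<phi> J"
    and "A \<subseteq> X"
    and "prethick G \<phi> J A"
  shows "large G (comb_derivation G \<phi> J A)"
proof -
  interpret group G by fact
  interpret group_action G X \<phi>
    using assms(2) transitive_action.axioms(1) by blast
  show ?thesis
  proof (cases "J = {}")
    case True
    then have "comb_derivation G \<phi> J A = carrier G"
      by (simp add: comb_derivation_def)
    moreover have "carrier G = {\<one>\<^bsub>G\<^esub>} <#>\<^bsub>G\<^esub> carrier G"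
      by (auto simp: set_mult_def)
    ultimately show ?thesis
      unfolding large_def by (intro exI[of _ "{\<one>\<^bsub>G\<^esub>}"]) simp
  next
    case False
    then have "{} \<in> J" using assms(4) unfolding ideal_of_sets_def by blast
    moreover obtain F where F: "finite F" "F \<subseteq> carrier G" "thick G \<phi> J (set_act \<phi> F A)"
      using assms(7) unfolding prethick_def by blast
    ultimately have "carrier G = F <#>\<^bsub>G\<^esub> comb_derivation G \<phi> J A"
      using assms(4-6) by (intro carrier_eq_set_mult_comb_derivation)
    then show ?thesis unfolding large_def using F by (intro exI[of _ F]) simp
  qed
qed

end
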